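(* Let $p\ge1$, $\sigma>0$ and let $P$ be a probability distribution on $\mathbb{R}^p$. The simplex enlarged $\sigma$-simplicial depth $d_{\triangle_\sigma}$ satisfies: (i) (affine invariance) for every nonsingular $p\times p$ matrix $A$, every $b\in\mathbb{R}^p$ and every $x\in\mathbb{R}^p$, $d_{\triangle_\sigma}(Ax+b;P_{A,b})=d_{\triangle_\sigma}(x;P)$, where $P_{A,b}$ is the distribution of $AX+b$ with $X\sim P$; (ii) (vanishing at infinity) $d_{\triangle_\sigma}(x;P)\to0$ as $\|x\|\to\infty$; (iii) $x\mapsto d_{\triangle_\sigma}(x;P)$ is upper semicontinuous on $\mathbb{R}^p$. Additionally, (iv) if $P$ is smooth, then $x\mapsto d_{\triangle_\sigma}(x;P)$ is continuous on $\mathbb{R}^p$.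
   Context: $\triangle[x_1,\dots,x_{p+1}]$ denotes the closed simplex (convex hull) with vertices $x_1,\dots,x_{p+1}\in\mathbb{R}^p$. For $\sigma>0$, $\triangle_\sigma[x_1,\dots,x_{p+1}]:=\triangle[y_1,\dots,y_{p+1}]$ with $y_i=\sigma(x_i-\bar x)+\bar x$ and $\bar x=\frac1{p+1}\sum_{j=1}^{p+1}x_j$. The simplex enlarged $\sigma$-simplicial depth of $x\in\mathbb{R}^p$ with respect to $P$ is $d_{\triangle_\sigma}(x;P):=\int \mathbf{I}(x\in\triangle_\sigma[x_1,\dots,x_{p+1}])\,dP(x_1)\cdots dP(x_{p+1})$, where $\mathbf{I}$ is the indicator function. A distribution $P$ on $\mathbb{R}^p$ is smooth if $P(L)=0$ for every (affine) hyperplane $L\subset\mathbb{R}^p$. *)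

theory Defs
  imports "HOL-Probability.Probability"
begin

(* A tuple x_1, ..., x_{p+1} of points of R^p, with p = CARD('n), is a function
   xs :: nat => real^'n of which only the values on {1..CARD('n) + 1} matter. *)

definition barycenter :: "(nat \<Rightarrow> real^'n) \<Rightarrow> real^'n" where
  "barycenter xs = (1 / (real CARD('n) + 1)) *\<^sub>R (\<Sum>j\<in>{1..CARD('n) + 1}. xs j)"

definition closed_simplex :: "(nat \<Rightarrow> real^'n) \<Rightarrow> (real^'n) set" where
  "closed_simplex xs = convex hull (xs ` {1..CARD('n) + 1})"

definition enlarged_simplex :: "real \<Rightarrow> (nat \<Rightarrow> real^'n) \<Rightarrow> (real^'n) set" where
  "enlarged_simplex \<sigma> xs =
     closed_simplex (\<lambda>i. \<sigma> *\<^sub>R (xs i - barycenter xs) + barycenter xs)"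

(* The Bochner integral is 0 by convention for a non-integrable integrand. This does not
   occur for a Borel probability measure P: the set of tuples whose enlarged simplex
   contains x is closed, hence measurable in the product space. *)
definition simplex_depth :: "real \<Rightarrow> (real^'n) measure \<Rightarrow> real^'n \<Rightarrow> real" where
  "simplex_depth \<sigma> P x =
     (\<integral>xs. indicator (enlarged_simplex \<sigma> xs) x \<partial>(Pi\<^sub>M {1..CARD('n) + 1} (\<lambda>_. P)))"

definition smooth_distribution :: "(real^'n) measure \<Rightarrow> bool" where
  "smooth_distribution P \<longleftrightarrow> (\<forall>a c. a \<noteq> 0 \<longrightarrow> measure P {x. a \<bullet> x = c} = 0)"

definition upper_semicontinuous :: "('a::topological_space \<Rightarrow> real) \<Rightarrow> bool" where
  "upper_semicontinuous f \<longleftrightarrow> (\<forall>x. \<forall>c > f x. \<forall>\<^sub>F y in nhds x. f y < c)"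

end

theory Submission
  imports Defs
begin

text \<open>
  The depth of \<open>x\<close> is the probability that the random compact simplex spanned by the enlarged
  vertices \<open>y\<^sub>i = \<sigma> (x\<^sub>i - m) + m\<close>, where \<open>m\<close> is the barycenter, contains \<open>x\<close>. Each of the four
  properties is a fact about a fixed simplex, integrated.

  Affine invariance holds because an affine map commutes with barycenters and convex hulls. The
  three limit statements all come from one form of the reverse Fatou lemma
  (\<open>eventually_prob_less\<close>): if almost every outcome outside an event \<open>B\<close> lies in only finitely many
  of the events \<open>A n\<close>, then the limit superior of the probabilities of the \<open>A n\<close> is at most that
  of \<open>B\<close>. A bounded simplex misses every sequence escaping to infinity, so \<open>B\<close> is empty there. A closed
  simplex that misses \<open>x\<close> misses nearby points, which gives upper semicontinuity. For lower
  semicontinuity the lemma is applied to the complements: a simplex that has \<open>x\<close> in its interior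
  contains all nearby points, so it remains to see that \<open>x\<close> is almost surely not on the frontier
  of the simplex (\<open>AE_enlarged_simplex_not_frontier\<close>).

  If \<open>x\<close> is on the frontier of the simplex in dimension \<open>p\<close>, it lies in a face spanned by the \<open>p\<close> vertices \<open>y\<^sub>j\<close> with
  \<open>j \<noteq> i\<close>, and some vertex \<open>y\<^sub>k\<close> of that face has barycentric weight at least \<open>1 / p\<close>. As every
  \<open>y\<^sub>j\<close> depends on all sample points through the barycenter, one has
  \<open>x = c x\<^sub>i + (\<Sum>j\<noteq>i. (c + \<sigma> w\<^sub>j) x\<^sub>j)\<close> with \<open>c = (1 - \<sigma>) / (p + 1)\<close>. The bound on \<open>w\<^sub>k\<close> keeps
  the coefficient of \<open>x\<^sub>k\<close> positive even when \<open>\<sigma> > 1\<close> makes \<open>c\<close> negative. Hence, once the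
  other sample points are fixed, \<open>x\<^sub>k\<close> lies in the affine hull of \<open>p\<close> fixed points, which is
  contained in a hyperplane and has probability zero under a smooth distribution. Fubini's theorem
  and a finite union over \<open>i\<close> and \<open>k\<close> finish the argument.
\<close>

section \<open>Measurability and limits of events\<close>

text \<open>
  A point outside the compact hull is strictly separated from it, and strict separation from
  finitely many points survives a small change of direction. So countably many directions decide
  membership, which is what makes membership in a random hull a measurable event.
\<close>

lemma mem_convex_hull_iff_dense_directions:
  fixes F :: "'a::euclidean_space set"
  assumes "finite F"
    and dense: "\<And>X. open X \<Longrightarrow> X \<noteq> {} \<Longrightarrow> \<exists>a\<in>D. a \<in> X"
  shows "x \<in> convex hull F \<longleftrightarrow> (\<forall>a\<in>D. \<exists>y\<in>F. a \<bullet> y \<le> a \<bullet> x)"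
proof
  assume x: "x \<in> convex hull F"
  show "\<forall>a\<in>D. \<exists>y\<in>F. a \<bullet> y \<le> a \<bullet> x"
  proof (rule ccontr)
    assume "\<not> ?thesis"
    then obtain a where "\<forall>y\<in>F. a \<bullet> x < a \<bullet> y" by (auto simp: not_le)
    then have "convex hull F \<subseteq> {y. a \<bullet> y > a \<bullet> x}"
      by (intro hull_minimal) (auto simp: convex_halfspace_gt)
    with x show False by auto
  qed
next
  assume *: "\<forall>a\<in>D. \<exists>y\<in>F. a \<bullet> y \<le> a \<bullet> x"
  show "x \<in> convex hull F"
  proof (rule ccontr)
    assume "x \<notin> convex hull F"
    then obtain a b where ab: "a \<bullet> x < b" "\<forall>y\<in>convex hull F. a \<bullet> y > b"
      using separating_hyperplane_closed_point[of "convex hull F" x] \<open>finite F\<close>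
      by (auto simp: compact_imp_closed finite_imp_compact_convex_hull)
    let ?U = "\<Inter>y\<in>F. {a. 0 < a \<bullet> (y - x)}"
    have "open ?U"
      using \<open>finite F\<close> by (intro open_INT) (auto intro!: open_Collect_less continuous_intros)
    moreover have "a \<in> ?U"
      using ab by (force simp: inner_diff_right intro: hull_inc)
    ultimately obtain d where "d \<in> D" "d \<in> ?U" using dense[of ?U] by blast
    with * show False by (fastforce simp: inner_diff_right)
  qed
qed

lemma measurable_mem_convex_hull:
  fixes f :: "'i \<Rightarrow> 'a \<Rightarrow> 'b::euclidean_space"
  assumes "finite J" and f: "\<And>j. j \<in> J \<Longrightarrow> f j \<in> borel_measurable M"
  shows "Measurable.pred M (\<lambda>\<omega>. x \<in> convex hull ((\<lambda>j. f j \<omega>) ` J))"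
proof -
  obtain D :: "'b set" where D: "countable D"
    "\<And>X. open X \<Longrightarrow> X \<noteq> {} \<Longrightarrow> \<exists>d\<in>D. d \<in> X"
    by (rule countable_dense_setE) blast
  have eq: "x \<in> convex hull ((\<lambda>j. f j \<omega>) ` J) \<longleftrightarrow> (\<forall>a\<in>D. \<exists>j\<in>J. a \<bullet> f j \<omega> \<le> a \<bullet> x)" for \<omega>
    using mem_convex_hull_iff_dense_directions[OF _ D(2), of "(\<lambda>j. f j \<omega>) ` J" x] \<open>finite J\<close> by simp
  have "Measurable.pred M (\<lambda>\<omega>. a \<bullet> f j \<omega> \<le> a \<bullet> x)" if "j \<in> J" for a j
    using f[OF that] by measurable
  then show ?thesis
    unfolding eq pred_def using D(1) \<open>finite J\<close>
    by (intro sets.sets_Collect_countable_All' sets.sets_Collect_finite_Ex) (auto simp: pred_def)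
qed

text \<open>
  The reverse Fatou lemma for events: the tail unions of the \<open>A n\<close> decrease to a set that is
  almost surely contained in \<open>B\<close>, and their probabilities converge by continuity from above.
\<close>

lemma (in prob_space) eventually_prob_less:
  assumes A [measurable]: "\<And>n. Measurable.pred M (A n)" and B [measurable]: "Measurable.pred M B"
    and ev: "AE \<omega> in M. \<not> B \<omega> \<longrightarrow> (\<forall>\<^sub>F n in sequentially. \<not> A n \<omega>)"
    and less: "\<P>(\<omega> in M. B \<omega>) < c"
  shows "\<forall>\<^sub>F n in sequentially. \<P>(\<omega> in M. A n \<omega>) < c"
proof -
  define T where "T m = {\<omega> \<in> space M. \<exists>n\<ge>m. A n \<omega>}" for m :: nat
  have T [measurable]: "T m \<in> sets M" for m unfolding T_def by measurable
  have "decseq T" unfolding decseq_def T_def by (auto intro: order_trans)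
  then have lim: "(\<lambda>m. prob (T m)) \<longlonglongrightarrow> prob (\<Inter>m. T m)"
    using T by (intro finite_Lim_measure_decseq) auto
  have "prob (\<Inter>m. T m) \<le> \<P>(\<omega> in M. B \<omega>)"
  proof (rule finite_measure_mono_AE)
    show "AE \<omega> in M. \<omega> \<in> (\<Inter>m. T m) \<longrightarrow> \<omega> \<in> {\<omega> \<in> space M. B \<omega>}"
      using ev by eventually_elim (auto simp: T_def eventually_sequentially)
  qed measurable
  with less have "prob (\<Inter>m. T m) < c" by simp
  with lim have "\<forall>\<^sub>F m in sequentially. prob (T m) < c" by (rule order_tendstoD)
  then show ?thesis
  proof eventually_elim
    case (elim m)
    have "\<P>(\<omega> in M. A m \<omega>) \<le> prob (T m)"
      by (intro finite_measure_mono) (auto simp: T_def)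
    with elim show ?case by simp
  qed
qed

section \<open>Faces of simplices\<close>

text \<open>
  In a convex combination of at most \<open>m\<close> points some weight is at least \<open>1 / m\<close>. The combinations
  that give \<open>v\<close> such a weight form the image of the hull under the homothety with center \<open>v\<close> and
  ratio \<open>1 - 1 / m\<close>. This form of the weight bound is again membership in the hull of a
  finite family, so it stays measurable for random points.
\<close>

lemma mem_convex_hull_heavy_vertex:
  fixes F :: "'a::real_vector set"
  assumes "finite F" and x: "x \<in> convex hull F" and "card F \<le> m" and "0 < m"
  shows "\<exists>v\<in>F. x \<in> convex hull ((\<lambda>y. (1 / m) *\<^sub>R v + (1 - 1 / m) *\<^sub>R y) ` F)"
proof -
  obtain u where u: "\<forall>y\<in>F. 0 \<le> u y" "sum u F = 1" "(\<Sum>y\<in>F. u y *\<^sub>R y) = x"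
    using x by (auto simp: convex_hull_finite[OF \<open>finite F\<close>])
  have "F \<noteq> {}" using u(2) by auto
  obtain v where v: "v \<in> F" "1 / m \<le> u v"
  proof (rule ccontr)
    assume "\<not> thesis"
    with that have "\<forall>y\<in>F. u y < 1 / m" by force
    then have "sum u F < (\<Sum>y\<in>F. 1 / m)"
      using \<open>finite F\<close> \<open>F \<noteq> {}\<close> by (intro sum_strict_mono) auto
    also have "\<dots> \<le> 1" using \<open>card F \<le> m\<close> \<open>0 < m\<close> by (simp add: field_simps)
    finally show False using u(2) by simp
  qed
  have "x \<in> (\<lambda>y. (1 / m) *\<^sub>R v + (1 - 1 / m) *\<^sub>R y) ` (convex hull F)"
  proof (cases "m = 1")
    case True
    with \<open>card F \<le> m\<close> v have "F = {v}"
      by (metis One_nat_def \<open>finite F\<close> card_le_Suc0_iff_eq insertI1 is_singletonI is_singleton_the_elem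
          singletonD subsetI subset_antisym subset_singletonD)
    with x True show ?thesis by simp
  next
    case False
    define r where "r = 1 - 1 / real m"
    have "r > 0" using False \<open>0 < m\<close> by (simp add: r_def)
    \<comment> \<open>Take the weight \<open>1 / m\<close> off \<open>v\<close> and rescale the remaining weights to total one.\<close>
    define w where "w y = (u y - (if y = v then 1 / m else 0)) / r" for y
    have "(\<Sum>y\<in>F. u y - (if y = v then 1 / m else 0)) = r"
      using u(2) v(1) \<open>finite F\<close> by (simp add: sum_subtractf r_def)
    then have "sum w F = 1"
      using \<open>r > 0\<close> by (simp add: w_def flip: sum_divide_distrib)
    moreover have "\<forall>y\<in>F. 0 \<le> w y"
      using u(1) v \<open>r > 0\<close> by (simp add: w_def)
    ultimately have "(\<Sum>y\<in>F. w y *\<^sub>R y) \<in> convex hull F"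
      by (auto simp: convex_hull_finite[OF \<open>finite F\<close>])
    moreover have "r *\<^sub>R (\<Sum>y\<in>F. w y *\<^sub>R y) = (\<Sum>y\<in>F. u y *\<^sub>R y - (if y = v then (1 / m) *\<^sub>R v else 0))"
      unfolding scaleR_sum_right
      using \<open>r > 0\<close> by (intro sum.cong) (auto simp: w_def scaleR_diff_left)
    then have "x = (1 / m) *\<^sub>R v + r *\<^sub>R (\<Sum>y\<in>F. w y *\<^sub>R y)"
      using u(3) v(1) \<open>finite F\<close> by (simp add: sum_subtractf)
    ultimately show ?thesis by (auto simp: r_def)
  qed
  then show ?thesis
    using v(1) by (auto simp: convex_hull_affinity)
qed

text \<open>
  A repeated member of the family can be dropped without changing the hull; distinct members are
  the vertices of a possibly flat simplex, whose frontier is the union of its faces.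
\<close>

lemma mem_frontier_convex_hull_family:
  fixes y :: "'i \<Rightarrow> 'a::euclidean_space"
  assumes "finite I" and card: "card I = DIM('a) + 1"
    and x: "x \<in> convex hull (y ` I)" "x \<notin> interior (convex hull (y ` I))"
  shows "\<exists>i\<in>I. x \<in> convex hull (y ` (I - {i}))"
proof (cases "inj_on y I")
  case True
  then have "card (y ` I) = Suc (DIM('a))" using card by (simp add: card_image)
  then have "frontier (convex hull (y ` I)) = \<Union>{convex hull (y ` I - {a}) |a. a \<in> y ` I}"
    by (rule frontier_of_convex_hull)
  moreover have "x \<in> frontier (convex hull (y ` I))"
    using x by (auto simp: frontier_def closure_def)
  ultimately obtain i where "i \<in> I" "x \<in> convex hull (y ` I - {y i})" by auto
  moreover have "y ` I - {y i} \<subseteq> y ` (I - {i})" by auto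
  ultimately show ?thesis by (meson hull_mono subsetD)
next
  case False
  then obtain i j where "i \<in> I" "j \<in> I" "i \<noteq> j" "y i = y j" by (auto simp: inj_on_def)
  then have "y ` I = y ` (I - {i})" by (auto simp: image_iff)
  with x \<open>i \<in> I\<close> show ?thesis by auto
qed

section \<open>Enlarged simplices\<close>

definition enlarged_vertex :: "real \<Rightarrow> (nat \<Rightarrow> real^'n) \<Rightarrow> nat \<Rightarrow> real^'n" where
  "enlarged_vertex \<sigma> xs i = \<sigma> *\<^sub>R (xs i - barycenter xs) + barycenter xs"

lemma enlarged_simplex_eq_hull:
  fixes xs :: "nat \<Rightarrow> real^'n"
  shows "enlarged_simplex \<sigma> xs = convex hull (enlarged_vertex \<sigma> xs ` {1..CARD('n) + 1})"
  unfolding enlarged_simplex_def closed_simplex_def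
  by (simp only: enlarged_vertex_def [abs_def])

lemma compact_enlarged_simplex: "compact (enlarged_simplex \<sigma> xs)"
  unfolding enlarged_simplex_eq_hull by (intro finite_imp_compact_convex_hull) auto

lemma measurable_enlarged_vertex:
  fixes P :: "(real^'n) measure"
  assumes "sets P = sets borel" and "i \<in> {1..CARD('n) + 1}"
  shows "(\<lambda>xs. enlarged_vertex \<sigma> xs i) \<in> borel_measurable (Pi\<^sub>M {1..CARD('n) + 1} (\<lambda>_. P))"
proof -
  have [measurable]: "(\<lambda>xs. xs j) \<in> borel_measurable (Pi\<^sub>M {1..CARD('n) + 1} (\<lambda>_. P))"
    if "j \<in> {1..CARD('n) + 1}" for j
    using measurable_component_singleton[OF that, of "\<lambda>_. P"] measurable_cong_sets[OF refl assms(1)] by blast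
  show ?thesis
    unfolding enlarged_vertex_def barycenter_def
    using assms(2) by (intro borel_measurable_add borel_measurable_diff borel_measurable_scaleR
        borel_measurable_sum borel_measurable_const; measurable)
qed

lemma measurable_mem_enlarged_simplex:
  fixes P :: "(real^'n) measure"
  assumes "sets P = sets borel"
  shows "Measurable.pred (Pi\<^sub>M {1..CARD('n) + 1} (\<lambda>_. P)) (\<lambda>xs. x \<in> enlarged_simplex \<sigma> xs)"
  unfolding enlarged_simplex_eq_hull
  using measurable_enlarged_vertex[OF assms] by (intro measurable_mem_convex_hull) auto

lemma simplex_depth_eq_prob:
  fixes P :: "(real^'n) measure"
  shows "simplex_depth \<sigma> P x =
    \<P>(xs in Pi\<^sub>M {1..CARD('n) + 1} (\<lambda>_. P). x \<in> enlarged_simplex \<sigma> xs)"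
proof -
  have "simplex_depth \<sigma> P x = (\<integral>xs. indicator {xs. x \<in> enlarged_simplex \<sigma> xs} xs \<partial>(Pi\<^sub>M {1..CARD('n) + 1} (\<lambda>_. P)))"
    unfolding simplex_depth_def by (intro Bochner_Integration.integral_cong) (auto simp: indicator_def)
  also have "\<dots> = \<P>(xs in Pi\<^sub>M {1..CARD('n) + 1} (\<lambda>_. P). x \<in> enlarged_simplex \<sigma> xs)"
    by (simp add: Int_def conj_commute)
  finally show ?thesis .
qed

lemma enlarged_simplex_affine_image:
  fixes A :: "real^'n^'n"
  assumes xs: "\<And>i. i \<in> {1..CARD('n) + 1} \<Longrightarrow> ys i = A *v xs i + b"
  shows "enlarged_simplex \<sigma> ys = (\<lambda>z. A *v z + b) ` enlarged_simplex \<sigma> xs"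
proof -
  let ?I = "{1..CARD('n) + 1}"
  have "barycenter ys = (1 / (real CARD('n) + 1)) *\<^sub>R (\<Sum>j\<in>?I. A *v xs j + b)"
    unfolding barycenter_def using xs by (intro arg_cong[where f = "\<lambda>v. _ *\<^sub>R v"] sum.cong) auto
  also have "\<dots> = A *v barycenter xs + b"
    unfolding barycenter_def
    by (simp add: sum.distrib scaleR_add_right sum_constant_scaleR matrix_vector_mult_scaleR
        linear_sum[OF matrix_vector_mul_linear] add.commute[of 1 "real _"]
        del: sum_constant sum.cl_ivl_Suc)
  finally have bary: "barycenter ys = A *v barycenter xs + b" .
  have "enlarged_vertex \<sigma> ys i = A *v enlarged_vertex \<sigma> xs i + b" if "i \<in> ?I" for i
    using xs[OF that] by (simp add: enlarged_vertex_def bary algebra_simps matrix_vector_mult_scaleR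
        matrix_vector_mult_diff_distrib)
  then have "enlarged_vertex \<sigma> ys ` ?I = (\<lambda>z. b + z) ` ((*v) A ` (enlarged_vertex \<sigma> xs ` ?I))"
    unfolding image_image by (intro image_cong) (auto simp: add.commute)
  then have "enlarged_simplex \<sigma> ys = (\<lambda>z. b + z) ` ((*v) A ` enlarged_simplex \<sigma> xs)"
    unfolding enlarged_simplex_eq_hull
    by (simp only: convex_hull_translation convex_hull_linear_image[OF matrix_vector_mul_linear])
  then show ?thesis by (simp add: image_image add.commute)
qed

section \<open>Degenerate tuples\<close>

text \<open>
  Let \<open>p = CARD('n)\<close>. All sample points except the \<open>k\<close>-th are fixed and the \<open>k\<close>-th, \<open>z\<close>, varies. If \<open>x\<close> lies on the
  face opposite to vertex \<open>i\<close> with weight at least \<open>1 / p\<close> on vertex \<open>k\<close>, solving for \<open>z\<close> places it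
  in the affine hull of the fixed points \<open>xs j\<close> (\<open>j \<noteq> i, k\<close>) and
  \<open>x' = (x - c xs i) / (1 - c)\<close>; these are \<open>p\<close> points, so some hyperplane \<open>a \<bullet> u = d\<close> contains them.
  Instead of solving for the weights, the proof evaluates \<open>a\<close>: if \<open>z\<close> is off the
  hyperplane, all the points spanning the heavy part of the face lie strictly on one side of \<open>x\<close>
  in the direction \<open>a\<close>.
\<close>

lemma heavy_face_hyperplane:
  fixes xs :: "nat \<Rightarrow> real^'n"
  defines "I \<equiv> {1..CARD('n) + 1}"
  assumes "\<sigma> > 0" and ik: "i \<in> I" "k \<in> I" "i \<noteq> k"
  shows "\<exists>a c. a \<noteq> 0 \<and> (\<forall>z. x \<in> convex hull ((\<lambda>j. (1 / CARD('n)) *\<^sub>R enlarged_vertex \<sigma> (xs(k := z)) k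
      + (1 - 1 / CARD('n)) *\<^sub>R enlarged_vertex \<sigma> (xs(k := z)) j) ` (I - {i})) \<longrightarrow> a \<bullet> z = c)"
proof -
  define m where "m = real CARD('n)"
  have m: "m \<ge> 1" unfolding m_def using zero_less_card_finite[where 'a='n] by linarith
  define c where "c = (1 - \<sigma>) / (m + 1)"
  \<comment> \<open>\<open>c\<close> is the coefficient with which each sample point enters every enlarged vertex through the
    barycenter. The two positive sums are the coefficients of \<open>z\<close> in the points spanning the heavy part.\<close>
  have c: "c < 1" "c + \<sigma> / m > 0" "c + \<sigma> > 0" "1 - \<sigma> = c * (m + 1)"
  proof -
    show "c < 1" "1 - \<sigma> = c * (m + 1)" using \<open>\<sigma> > 0\<close> m by (auto simp: c_def field_simps)
    have "c + \<sigma> / m = (m + \<sigma>) / (m * (m + 1))" "c + \<sigma> = (1 + \<sigma> * m) / (m + 1)"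
      using m by (auto simp: c_def field_simps)
    then show "c + \<sigma> / m > 0" "c + \<sigma> > 0" using \<open>\<sigma> > 0\<close> m by (auto intro!: divide_pos_pos add_pos_pos)
  qed
  define x' where "x' = (1 / (1 - c)) *\<^sub>R (x - c *\<^sub>R xs i)"
  define S where "S = insert x' (xs ` (I - {i, k}))"
  have "finite S" by (simp add: S_def I_def)
  have "card (I - {i, k}) = CARD('n) - 1"
    using ik by (subst card_Diff_subset) (auto simp: I_def)
  then have "card (xs ` (I - {i, k})) \<le> CARD('n) - 1"
    by (metis I_def card_image_le finite_Diff finite_atLeastAtMost)
  then have "card S \<le> CARD('n)"
    unfolding S_def using m zero_less_card_finite[where 'a='n]
    by (intro order_trans[OF card_insert_le_m1]) auto
  then have "aff_dim S < DIM(real^'n)"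
    using aff_dim_le_card[OF \<open>finite S\<close>] by simp
  then obtain a d where a: "a \<noteq> 0" and S: "S \<subseteq> {z. a \<bullet> z = d}"
    by (rule aff_lowdim_subset_hyperplane)
  have "a \<bullet> z = d" if x: "x \<in> convex hull ((\<lambda>j. (1 / CARD('n)) *\<^sub>R enlarged_vertex \<sigma> (xs(k := z)) k
      + (1 - 1 / CARD('n)) *\<^sub>R enlarged_vertex \<sigma> (xs(k := z)) j) ` (I - {i}))"
      (is "x \<in> convex hull (?q ` _)") for z
  proof (rule ccontr)
    assume neq: "a \<bullet> z \<noteq> d"
    define s where "s = a \<bullet> z - d"
    define t where "t = a \<bullet> xs i - d"
    have "a \<bullet> x' = d" using S by (auto simp: S_def)
    moreover have "x = (1 - c) *\<^sub>R x' + c *\<^sub>R xs i"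
      using c(1) by (simp add: x'_def)
    then have "a \<bullet> x = (1 - c) * (a \<bullet> x') + c * (a \<bullet> xs i)"
      by (simp only: inner_add_right inner_scaleR_right)
    ultimately have ax: "a \<bullet> x = d + c * t"
      by (simp add: t_def algebra_simps)
    have ay: "a \<bullet> (xs(k := z)) j = (if j = k then d + s else if j = i then d + t else d)" if "j \<in> I" for j
      using S that by (auto simp: S_def s_def t_def)
    have "(\<Sum>j\<in>I. a \<bullet> (xs(k := z)) j) = (\<Sum>j\<in>I. d + (if j = k then s else 0) + (if j = i then t else 0))"
      using ay ik by (intro sum.cong) auto
    also have "\<dots> = (m + 1) * d + s + t"
      using ik by (simp add: sum.distrib I_def m_def algebra_simps)
    finally have "(m + 1) * (a \<bullet> barycenter (xs(k := z))) = (m + 1) * d + s + t"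
      unfolding barycenter_def I_def[symmetric] m_def[symmetric] inner_scaleR_right inner_sum_right
      using m by simp
    then have ab: "(1 - \<sigma>) * (a \<bullet> barycenter (xs(k := z))) = (1 - \<sigma>) * d + c * (s + t)"
      unfolding c(4) by (simp only: mult.assoc) (simp only: distrib_left[of c, symmetric] add.assoc)
    have av: "a \<bullet> enlarged_vertex \<sigma> (xs(k := z)) j = d + (if j = k then \<sigma> * s else 0) + c * (s + t)"
      if "j \<in> I - {i}" for j
    proof -
      have "a \<bullet> enlarged_vertex \<sigma> (xs(k := z)) j
          = \<sigma> * (a \<bullet> (xs(k := z)) j) + (1 - \<sigma>) * (a \<bullet> barycenter (xs(k := z)))"
        by (simp add: enlarged_vertex_def inner_add_right inner_diff_right algebra_simps
            del: fun_upd_apply)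
      then show ?thesis
        unfolding ab using ay[of j] that
        by (cases "j = k") (simp_all add: algebra_simps del: fun_upd_apply)
    qed
    have aq: "a \<bullet> ?q j - a \<bullet> x = (if j = k then c + \<sigma> else c + \<sigma> / m) * s" if "j \<in> I - {i}" for j
    proof -
      have "a \<bullet> ?q j = (1 / m) * (a \<bullet> enlarged_vertex \<sigma> (xs(k := z)) k)
          + (1 - 1 / m) * (a \<bullet> enlarged_vertex \<sigma> (xs(k := z)) j)"
        by (simp add: inner_add_right m_def)
      then have "a \<bullet> ?q j = (1 / m) * (d + \<sigma> * s + c * (s + t))
          + (1 - 1 / m) * (d + (if j = k then \<sigma> * s else 0) + c * (s + t))"
        using av[of k] av[OF that] ik by (simp del: fun_upd_apply)
      also have "\<dots> - a \<bullet> x = (if j = k then c + \<sigma> else c + \<sigma> / m) * s"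
        unfolding ax using m by (simp add: field_simps)
      finally show ?thesis .
    qed
    show False
    proof (cases "s > 0")
      case True
      have "?q ` (I - {i}) \<subseteq> {y. a \<bullet> y > a \<bullet> x}"
      proof safe
        fix j assume "j \<in> I" "j \<noteq> i"
        then have "a \<bullet> ?q j - a \<bullet> x > 0" using aq[of j] c True by simp
        then show "a \<bullet> ?q j > a \<bullet> x" by simp
      qed
      then have "convex hull (?q ` (I - {i})) \<subseteq> {y. a \<bullet> y > a \<bullet> x}"
        by (intro hull_minimal convex_halfspace_gt)
      with x show False by auto
    next
      case False
      with neq have "s < 0" by (simp add: s_def)
      have "?q ` (I - {i}) \<subseteq> {y. a \<bullet> y < a \<bullet> x}"
      proof safe
        fix j assume "j \<in> I" "j \<noteq> i"
        then have "a \<bullet> ?q j - a \<bullet> x < 0" using aq[of j] c \<open>s < 0\<close> by (simp add: mult_pos_neg)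
        then show "a \<bullet> ?q j < a \<bullet> x" by simp
      qed
      then have "convex hull (?q ` (I - {i})) \<subseteq> {y. a \<bullet> y < a \<bullet> x}"
        by (intro hull_minimal convex_halfspace_lt)
      with x show False by auto
    qed
  qed
  with a show ?thesis by blast
qed

text \<open>
  Fubini in one coordinate: a measurable property that holds almost surely in the coordinate \<open>k\<close>,
  whatever the other coordinates are, holds almost surely.
\<close>

lemma AE_PiM_if_AE_component:
  assumes "\<And>i. prob_space (M i)" and "finite I" and "k \<in> I" and Q: "Measurable.pred (Pi\<^sub>M I M) Q"
    and AE: "\<And>xs. AE z in M k. Q (xs(k := z))"
  shows "AE xs in Pi\<^sub>M I M. Q xs"
proof -
  interpret product_prob_space M by (simp add: product_prob_spaceI assms(1))
  define J where "J = I - {k}"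
  have J: "finite J" "k \<notin> J" "insert k J = I" using assms by (auto simp: J_def)
  have Q' [measurable]: "Measurable.pred (Pi\<^sub>M I M) (\<lambda>xs. \<not> Q xs)" using Q by measurable
  let ?N = "{xs \<in> space (Pi\<^sub>M I M). \<not> Q xs}"
  have N: "?N \<in> sets (Pi\<^sub>M I M)" by measurable
  then have "emeasure (Pi\<^sub>M I M) ?N = (\<integral>\<^sup>+xs. indicator ?N xs \<partial>Pi\<^sub>M I M)" by simp
  also have "\<dots> = (\<integral>\<^sup>+xs. \<integral>\<^sup>+z. indicator ?N (xs(k := z)) \<partial>M k \<partial>Pi\<^sub>M J M)"
    using product_nn_integral_insert[OF J(1,2), of "indicator ?N"] N by (simp add: J(3))
  also have "\<dots> = (\<integral>\<^sup>+xs. \<integral>\<^sup>+z. 0 \<partial>M k \<partial>Pi\<^sub>M J M)"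
  proof (rule nn_integral_cong, rule nn_integral_cong_AE)
    fix xs
    show "AE z in M k. indicator ?N (xs(k := z)) = (0::ennreal)"
      using AE[of xs] by eventually_elim simp
  qed
  finally have "emeasure (Pi\<^sub>M I M) ?N = 0" by simp
  with N show ?thesis by (auto simp: AE_iff_measurable[OF _ refl])
qed

text \<open>
  The frontier event itself is replaced by the finitely many measurable events that \<open>x\<close> lies in the
  heavy part, around vertex \<open>k\<close>, of the face opposite to vertex \<open>i\<close>. Each is null by the
  hyperplane lemma.
\<close>

lemma AE_enlarged_simplex_not_frontier:
  fixes P :: "(real^'n) measure"
  assumes "\<sigma> > 0" and P: "prob_space P" "sets P = sets borel" and "smooth_distribution P"
  shows "AE xs in Pi\<^sub>M {1..CARD('n) + 1} (\<lambda>_. P). x \<notin> frontier (enlarged_simplex \<sigma> xs)"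
proof -
  interpret P: prob_space P by fact
  define I where "I = {1..CARD('n) + 1}"
  have I: "finite I" "card I = CARD('n) + 1" by (auto simp: I_def)
  let ?q = "\<lambda>k xs j. (1 / CARD('n)) *\<^sub>R enlarged_vertex \<sigma> xs k
      + (1 - 1 / CARD('n)) *\<^sub>R enlarged_vertex \<sigma> xs j :: real^'n"
  have null: "AE xs in Pi\<^sub>M I (\<lambda>_. P). x \<notin> convex hull (?q k xs ` (I - {i}))"
    if ik: "i \<in> I" "k \<in> I" "i \<noteq> k" for i k
  proof (rule AE_PiM_if_AE_component)
    have [measurable]: "(\<lambda>xs. enlarged_vertex \<sigma> xs j) \<in> borel_measurable (Pi\<^sub>M I (\<lambda>_. P))" if "j \<in> I" for j
      using measurable_enlarged_vertex[OF P(2), of j \<sigma>] that by (simp add: I_def)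
    have "Measurable.pred (Pi\<^sub>M I (\<lambda>_. P)) (\<lambda>xs. x \<in> convex hull ((\<lambda>j. ?q k xs j) ` (I - {i})))"
    proof (intro measurable_mem_convex_hull)
      fix j assume "j \<in> I - {i}"
      then have "j \<in> I" by simp
      then show "(\<lambda>xs. ?q k xs j) \<in> borel_measurable (Pi\<^sub>M I (\<lambda>_. P))"
        using ik by measurable
    qed (use I in auto)
    then show "Measurable.pred (Pi\<^sub>M I (\<lambda>_. P)) (\<lambda>xs. x \<notin> convex hull (?q k xs ` (I - {i})))"
      by simp
    fix xs :: "nat \<Rightarrow> real^'n"
    obtain a c where a: "a \<noteq> 0"
      and z: "\<And>z. x \<in> convex hull (?q k (xs(k := z)) ` (I - {i})) \<Longrightarrow> a \<bullet> z = c"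
      using heavy_face_hyperplane[OF \<open>\<sigma> > 0\<close>, of i k x xs] ik unfolding I_def by blast
    have "AE z in P. z \<notin> {z. a \<bullet> z = c}"
    proof (rule AE_not_in)
      have "{z. a \<bullet> z = c} \<in> sets P"
        unfolding P(2) by (intro borel_closed closed_hyperplane)
      then show "{z. a \<bullet> z = c} \<in> null_sets P"
        using \<open>smooth_distribution P\<close> a
        by (auto simp: smooth_distribution_def P.emeasure_eq_measure intro!: null_setsI)
    qed
    then show "AE z in P. x \<notin> convex hull (?q k (xs(k := z)) ` (I - {i}))"
      by eventually_elim (use z in auto)
  qed (use I ik P in auto)
  have "AE xs in Pi\<^sub>M I (\<lambda>_. P). \<forall>i\<in>I. \<forall>k\<in>I - {i}. x \<notin> convex hull (?q k xs ` (I - {i}))"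
    using null I by (intro AE_finite_allI) auto
  then show ?thesis
    unfolding I_def[symmetric]
  proof eventually_elim
    case (elim xs)
    show ?case
    proof
      assume "x \<in> frontier (enlarged_simplex \<sigma> xs)"
      then have "x \<in> enlarged_simplex \<sigma> xs" "x \<notin> interior (enlarged_simplex \<sigma> xs)"
        using compact_imp_closed[OF compact_enlarged_simplex[of \<sigma> xs]]
        by (auto simp: frontier_def)
      then obtain i where i: "i \<in> I" "x \<in> convex hull (enlarged_vertex \<sigma> xs ` (I - {i}))"
        using mem_frontier_convex_hull_family[of I x "enlarged_vertex \<sigma> xs"] I
        unfolding enlarged_simplex_eq_hull I_def[symmetric] by auto
      have "card (enlarged_vertex \<sigma> xs ` (I - {i})) \<le> CARD('n)"
        using card_image_le[of "I - {i}" "enlarged_vertex \<sigma> xs"] I i(1) by simp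
      then obtain k where "k \<in> I - {i}" "x \<in> convex hull (?q k xs ` (I - {i}))"
        using mem_convex_hull_heavy_vertex[OF _ i(2), of "CARD('n)"] I
        by (auto simp: image_image)
      with elim i show False by auto
    qed
  qed
qed

section \<open>Affine invariance and limits of the depth\<close>

lemma simplex_depth_affine_invariant:
  fixes P :: "(real^'n) measure" and A :: "real^'n^'n"
  assumes P: "prob_space P" "sets P = sets borel" and "invertible A"
  shows "simplex_depth \<sigma> (distr P borel (\<lambda>z. A *v z + b)) (A *v x + b) = simplex_depth \<sigma> P x"
proof -
  let ?I = "{1..CARD('n) + 1}" and ?f = "\<lambda>z. A *v z + b"
  let ?Q = "distr P borel ?f"
  have f: "?f \<in> borel_measurable borel"
    by (intro borel_measurable_continuous_onI continuous_intros linear_continuous_on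
        linear_linear[THEN iffD2] matrix_vector_mul_linear)
  then have f [measurable]: "?f \<in> P \<rightarrow>\<^sub>M borel" using measurable_cong_sets[OF P(2) refl] by blast
  have inj: "inj ((*v) A)"
    using \<open>invertible A\<close> by (rule inj_matrix_vector_mult)
  have "prob_space ?Q" using P(1) f by (rule prob_space.prob_space_distr)
  \<comment> \<open>The rule for products of image measures asks for a probability space as target, which the
    bare Borel space is not; hence the detour through \<open>?Q\<close>, which has the same events.\<close>
  have "distr P ?Q ?f = ?Q" by (rule distr_cong) auto
  then have "Pi\<^sub>M ?I (\<lambda>_. ?Q) = distr (Pi\<^sub>M ?I (\<lambda>_. P)) (Pi\<^sub>M ?I (\<lambda>_. ?Q)) (compose ?I ?f)"
    using distr_PiM_finite_prob_space'[of ?I "\<lambda>_. P" "\<lambda>_. ?Q" ?f] P(1) \<open>prob_space ?Q\<close> by simp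
  also have "\<dots> = distr (Pi\<^sub>M ?I (\<lambda>_. P)) (Pi\<^sub>M ?I (\<lambda>_. borel)) (compose ?I ?f)"
    by (intro distr_cong refl sets_PiM_cong) auto
  finally have distr: "Pi\<^sub>M ?I (\<lambda>_. ?Q) = \<dots>" .
  have compose: "compose ?I ?f \<in> Pi\<^sub>M ?I (\<lambda>_. P) \<rightarrow>\<^sub>M Pi\<^sub>M ?I (\<lambda>_. borel)"
    unfolding compose_def by measurable
  have mem: "?f x \<in> enlarged_simplex \<sigma> (compose ?I ?f xs) \<longleftrightarrow> x \<in> enlarged_simplex \<sigma> xs"
    for xs :: "nat \<Rightarrow> real^'n"
    by (subst enlarged_simplex_affine_image[where xs = xs]) (auto simp: compose_def dest: injD[OF inj])
  have "simplex_depth \<sigma> ?Q (?f x) = measure (Pi\<^sub>M ?I (\<lambda>_. P))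
      (compose ?I ?f -` {xs \<in> space (Pi\<^sub>M ?I (\<lambda>_. borel)). ?f x \<in> enlarged_simplex \<sigma> xs}
        \<inter> space (Pi\<^sub>M ?I (\<lambda>_. P)))"
    unfolding simplex_depth_eq_prob distr space_distr
    using measurable_mem_enlarged_simplex[OF refl, of "?f x" \<sigma>] compose
    by (intro measure_distr) (auto simp: pred_def)
  also have "\<dots> = simplex_depth \<sigma> P x"
    unfolding simplex_depth_eq_prob
    using measurable_space[OF compose] mem by (intro arg_cong[where f = "measure _"]) auto
  finally show ?thesis .
qed

theorem theorem12:
  fixes P :: "(real^'n) measure" and \<sigma> :: real
  assumes "\<sigma> > 0" and "prob_space P" and "sets P = sets borel"
  shows "(\<forall>(A :: real^'n^'n) b x. invertible A \<longrightarrow>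
            simplex_depth \<sigma> (distr P borel (\<lambda>z. A *v z + b)) (A *v x + b) = simplex_depth \<sigma> P x)
       \<and> (simplex_depth \<sigma> P \<longlongrightarrow> 0) at_infinity
       \<and> upper_semicontinuous (simplex_depth \<sigma> P)
       \<and> (smooth_distribution P \<longrightarrow> continuous_on UNIV (simplex_depth \<sigma> P))"
proof -
  define M where "M = Pi\<^sub>M {1..CARD('n) + 1} (\<lambda>_. P)"
  let ?D = "simplex_depth \<sigma> P"
  interpret M: prob_space M unfolding M_def using assms by (intro prob_space_PiM) auto
  have [measurable]: "Measurable.pred M (\<lambda>xs. z \<in> enlarged_simplex \<sigma> xs)" for z
    unfolding M_def by (rule measurable_mem_enlarged_simplex[OF assms(3)])
  have depth: "?D z = \<P>(xs in M. z \<in> enlarged_simplex \<sigma> xs)" for z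
    unfolding M_def by (rule simplex_depth_eq_prob)
  have outside: "\<forall>\<^sub>F n in sequentially. y n \<notin> enlarged_simplex \<sigma> xs"
    if "y \<longlonglongrightarrow> x" "x \<notin> enlarged_simplex \<sigma> xs" for y x and xs :: "nat \<Rightarrow> real^'n"
    using topological_tendstoD[OF that(1), of "- enlarged_simplex \<sigma> xs"] that(2)
      compact_imp_closed[OF compact_enlarged_simplex[of \<sigma> xs]] by (simp add: open_Compl)
  have usc: "\<forall>\<^sub>F y in nhds x. ?D y < c" if "?D x < c" for x c
  proof (unfold eventually_nhds_iff_sequentially, intro allI impI)
    fix y :: "nat \<Rightarrow> real^'n" assume "y \<longlonglongrightarrow> x"
    then show "\<forall>\<^sub>F n in sequentially. ?D (y n) < c"
      using that outside unfolding depth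
      by (intro M.eventually_prob_less[where B = "\<lambda>xs. x \<in> enlarged_simplex \<sigma> xs"]) auto
  qed
  have lsc: "\<forall>\<^sub>F y in nhds x. c < ?D y" if "c < ?D x" "smooth_distribution P" for x c
  proof (unfold eventually_nhds_iff_sequentially, intro allI impI)
    fix y :: "nat \<Rightarrow> real^'n" assume y: "y \<longlonglongrightarrow> x"
    \<comment> \<open>Lower semicontinuity is the reverse Fatou lemma for the complementary events.\<close>
    have compl: "\<P>(xs in M. z \<notin> enlarged_simplex \<sigma> xs) = 1 - ?D z" for z
      unfolding depth by (intro M.prob_neg) measurable
    have "AE xs in M. x \<notin> frontier (enlarged_simplex \<sigma> xs)"
      unfolding M_def using AE_enlarged_simplex_not_frontier that assms by blast
    then have "AE xs in M. \<not> x \<notin> enlarged_simplex \<sigma> xs \<longrightarrow>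
        (\<forall>\<^sub>F n in sequentially. \<not> y n \<notin> enlarged_simplex \<sigma> xs)"
    proof eventually_elim
      case (elim xs)
      show ?case
      proof
        assume "\<not> x \<notin> enlarged_simplex \<sigma> xs"
        with elim have "x \<in> interior (enlarged_simplex \<sigma> xs)"
          using closure_subset by (auto simp: frontier_def)
        then have "\<forall>\<^sub>F n in sequentially. y n \<in> interior (enlarged_simplex \<sigma> xs)"
          by (intro topological_tendstoD[OF y]) auto
        then show "\<forall>\<^sub>F n in sequentially. \<not> y n \<notin> enlarged_simplex \<sigma> xs"
          by eventually_elim (use interior_subset in auto)
      qed
    qed
    then have "\<forall>\<^sub>F n in sequentially. \<P>(xs in M. y n \<notin> enlarged_simplex \<sigma> xs) < 1 - c"
      using that by (intro M.eventually_prob_less[where B = "\<lambda>xs. x \<notin> enlarged_simplex \<sigma> xs"])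
        (simp_all add: compl)
    then show "\<forall>\<^sub>F n in sequentially. c < ?D (y n)"
      unfolding compl by simp
  qed
  have vanish: "\<exists>B. \<forall>y. norm y \<ge> B \<longrightarrow> ?D y < e" if "e > 0" for e
  proof (rule ccontr)
    assume "\<not> ?thesis"
    then have "\<forall>n. \<exists>y. norm y \<ge> real n \<and> \<not> ?D y < e" by blast
    then obtain y where y: "\<And>n. norm (y n) \<ge> real n" "\<And>n. \<not> ?D (y n) < e" by metis
    have "\<forall>\<^sub>F n in sequentially. y n \<notin> enlarged_simplex \<sigma> xs" for xs :: "nat \<Rightarrow> real^'n"
    proof -
      obtain B where B: "\<And>z. z \<in> enlarged_simplex \<sigma> xs \<Longrightarrow> norm z \<le> B"
        using compact_imp_bounded[OF compact_enlarged_simplex[of \<sigma> xs]] by (auto simp: bounded_iff)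
      have "\<forall>\<^sub>F n in sequentially. B < real n"
        using filterlim_real_sequentially by (auto simp: filterlim_at_top_dense)
      then show ?thesis
        by eventually_elim (use B y(1) in \<open>force dest: order_trans\<close>)
    qed
    then have "\<forall>\<^sub>F n in sequentially. ?D (y n) < e"
      using that unfolding depth
      by (intro M.eventually_prob_less[where B = "\<lambda>_. False"]) auto
    with y(2) show False by simp
  qed
  have "(?D \<longlongrightarrow> 0) at_infinity"
  proof (rule order_tendstoI)
    fix a :: real assume "a < 0"
    then show "\<forall>\<^sub>F y in at_infinity. a < ?D y"
      by (intro always_eventually) (auto simp: depth intro: less_le_trans)
  qed (use vanish in \<open>auto simp: eventually_at_infinity\<close>)
  moreover have "continuous_on UNIV ?D" if "smooth_distribution P"
  proof (intro continuous_at_imp_continuous_on ballI)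
    fix x
    have "(?D \<longlongrightarrow> ?D x) (nhds x)"
      using usc lsc that by (intro order_tendstoI) auto
    then show "isCont ?D x"
      unfolding isCont_def by (rule tendsto_mono[OF at_within_le_nhds])
  qed
  ultimately show ?thesis
    using usc simplex_depth_affine_invariant assms by (auto simp: upper_semicontinuous_def)
qed

end
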